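(* Let $\Omega$ be the feasible set of the primal problem, let $N$ be the set of all $x\in\Omega$ such that $u_i=1$ and $g_i=0$ for at least one $i\in I$ with $w_i\ne 0$, let $\Omega'=\Omega\setminus N$, and let $\overline{\Omega}$ be the set of all attainable schedules (defined in the context). Then $\Omega'=\overline{\Omega}$.
   Context: Market data: $I=\{1,\dots,|I|\}$ is a finite nonempty set of generating units; for each $i\in I$: $g_i^{\max}>0$, $w_i\ge 0$, and $c_i:[0,g_i^{\max}]\to\mathbb{R}$ is a non-decreasing convex continuous function with $c_i(0)=0$. The demand $d$ is a fixed real number with $0\le d\le\sum_{i\in I}g_i^{\max}$. For $x_i=(u_i,g_i)$ the cost is $C_i(x_i)=c_i(g_i)+w_iu_i$, and the private feasible set is $X_i=\{(u_i,g_i): u_i\in\{0,1\},\ g_i\in\mathbb{R},\ 0\le g_i\le u_ig_i^{\max}\}$. The feasible set of the primal problem is $\Omega=\{x=(x_i)_{i\in I}: x_i=(u_i,g_i)\in X_i\ \forall i\in I,\ \sum_{i\in I}g_i=d\}$. Attainable schedules: $\overline{\Omega}$ is the set of all $\bar x=(\bar x_i)_{i\in I}$, $\bar x_i=(\bar u_i,\bar g_i)$ with $\bar u_i\in\{0,1\}$ and $0\le\bar g_i\le g_i^{\max}$, such that $\bar x$ is a minimizer of $\sum_{i\in I}C_i(x_i)$ over the set of all $x\in\Omega$ satisfying $u_i\le\bar u_i$ and $g_i\le\bar g_i$ for all $i\in I$ (in particular $\bar x$ itself belongs to $\Omega$). *)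

theory Defs
  imports "HOL-Analysis.Analysis" "HOL-Library.FuncSet"
begin

text \<open>
  A schedule is an extensional function from the set of units \<open>I\<close> to pairs \<open>(u, g)\<close>, so that
  schedules that agree on \<open>I\<close> are equal.
\<close>

definition unit_cost :: "('i \<Rightarrow> real \<Rightarrow> real) \<Rightarrow> ('i \<Rightarrow> real) \<Rightarrow> 'i \<Rightarrow> real \<times> real \<Rightarrow> real" where
  "unit_cost c w i = (\<lambda>(u, g). c i g + w i * u)"

definition total_cost ::
    "'i set \<Rightarrow> ('i \<Rightarrow> real \<Rightarrow> real) \<Rightarrow> ('i \<Rightarrow> real) \<Rightarrow> ('i \<Rightarrow> real \<times> real) \<Rightarrow> real" where
  "total_cost I c w x = (\<Sum>i\<in>I. unit_cost c w i (x i))"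

definition private_feasible :: "('i \<Rightarrow> real) \<Rightarrow> 'i \<Rightarrow> (real \<times> real) set" where
  "private_feasible gmax i = {(u, g). u \<in> {0, 1} \<and> 0 \<le> g \<and> g \<le> u * gmax i}"

definition primal_feasible :: "'i set \<Rightarrow> ('i \<Rightarrow> real) \<Rightarrow> real \<Rightarrow> ('i \<Rightarrow> real \<times> real) set" where
  "primal_feasible I gmax d =
     {x \<in> (\<Pi>\<^sub>E i\<in>I. private_feasible gmax i). (\<Sum>i\<in>I. snd (x i)) = d}"

definition idle_committed ::
    "'i set \<Rightarrow> ('i \<Rightarrow> real) \<Rightarrow> ('i \<Rightarrow> real) \<Rightarrow> real \<Rightarrow> ('i \<Rightarrow> real \<times> real) set" where
  "idle_committed I gmax w d =
     {x \<in> primal_feasible I gmax d. \<exists>i\<in>I. w i \<noteq> 0 \<and> fst (x i) = 1 \<and> snd (x i) = 0}"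

definition attainable ::
    "'i set \<Rightarrow> ('i \<Rightarrow> real) \<Rightarrow> ('i \<Rightarrow> real \<Rightarrow> real) \<Rightarrow> ('i \<Rightarrow> real) \<Rightarrow> real
      \<Rightarrow> ('i \<Rightarrow> real \<times> real) set" where
  "attainable I gmax c w d =
     {xb \<in> (\<Pi>\<^sub>E i\<in>I. {0, 1} \<times> {0..gmax i}).
        is_arg_min (total_cost I c w)
          (\<lambda>x. x \<in> primal_feasible I gmax d \<and>
               (\<forall>i\<in>I. fst (x i) \<le> fst (xb i) \<and> snd (x i) \<le> snd (xb i))) xb}"

end

theory Submission
  imports Defs
begin

text \<open>
  The generation levels of a feasible schedule add up to the demand. A feasible schedule that is
  bounded componentwise by another feasible one therefore has the same generation levels
  (\<open>dominated_dispatch_eq\<close>), and the only freedom left is to switch off units that produce nothing.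
  Switching off the idle unit \<open>i\<close> saves exactly its fixed cost \<open>w i\<close>
  (\<open>total_cost_switch_off\<close>). So a feasible schedule is optimal among those it dominates exactly
  when no unit with a nonzero fixed cost is committed and idle. Since generation never changes, the
  variable costs cancel from every comparison.
\<close>

lemma private_feasibleD:
  assumes "p \<in> private_feasible gmax i"
  shows "fst p = 0 \<or> fst p = 1" "0 \<le> snd p" "snd p \<le> fst p * gmax i"
  using assms by (auto simp: private_feasible_def)

lemma primal_feasibleD:
  assumes "x \<in> primal_feasible I gmax d"
  shows "\<And>i. i \<in> I \<Longrightarrow> x i \<in> private_feasible gmax i" "(\<Sum>i\<in>I. snd (x i)) = d"
  using assms by (auto simp: primal_feasible_def)

lemma primal_feasible_within_capacity:
  assumes "\<And>i. i \<in> I \<Longrightarrow> 0 \<le> gmax i" and "x \<in> primal_feasible I gmax d"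
  shows "x \<in> (\<Pi>\<^sub>E i\<in>I. {0, 1} \<times> {0..gmax i})"
proof -
  have "x i \<in> {0, 1} \<times> {0..gmax i}" if "i \<in> I" for i
    using private_feasibleD[OF primal_feasibleD(1)[OF assms(2) that]] assms(1)[OF that]
    by (auto simp: mem_Times_iff)
  then show ?thesis
    using assms(2) by (auto simp: primal_feasible_def PiE_iff)
qed

text \<open>Two sums of the same value, one bounded termwise by the other, agree term by term.\<close>

lemma dominated_dispatch_eq:
  assumes "finite I"
    and "x \<in> primal_feasible I gmax d" and "y \<in> primal_feasible I gmax d"
    and "\<And>i. i \<in> I \<Longrightarrow> snd (y i) \<le> snd (x i)"
    and "i \<in> I"
  shows "snd (y i) = snd (x i)"
proof (rule sum_mono_inv[OF _ assms(4) assms(5) assms(1)])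
  show "(\<Sum>i\<in>I. snd (y i)) = (\<Sum>i\<in>I. snd (x i))"
    using primal_feasibleD(2)[OF assms(2)] primal_feasibleD(2)[OF assms(3)] by simp
qed

text \<open>
  Generation is the same in both schedules. The commitment of a unit can differ only where \<open>x\<close>
  commits the unit and \<open>y\<close> does not; such a unit is idle, so its fixed cost vanishes.
\<close>

lemma total_cost_dominated_eq:
  assumes "finite I"
    and x: "x \<in> primal_feasible I gmax d" and "x \<notin> idle_committed I gmax w d"
    and y: "y \<in> primal_feasible I gmax d"
    and le: "\<And>i. i \<in> I \<Longrightarrow> fst (y i) \<le> fst (x i) \<and> snd (y i) \<le> snd (x i)"
  shows "total_cost I c w y = total_cost I c w x"
  unfolding total_cost_def
proof (rule sum.cong[OF refl])
  fix i assume i: "i \<in> I"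
  have g: "snd (y i) = snd (x i)"
    using dominated_dispatch_eq[OF assms(1) x y _ i] le by blast
  have "w i * fst (y i) = w i * fst (x i)"
  proof (cases "fst (y i) = fst (x i)")
    case False
    have "fst (x i) = 1 \<and> fst (y i) = 0"
      using False le[OF i] private_feasibleD(1)[OF primal_feasibleD(1)[OF x i]]
        private_feasibleD(1)[OF primal_feasibleD(1)[OF y i]] by auto
    moreover from this have "snd (x i) = 0"
      using private_feasibleD(2,3)[OF primal_feasibleD(1)[OF y i]] g by simp
    ultimately have "w i = 0"
      using x i assms(3) by (auto simp: idle_committed_def)
    then show ?thesis by simp
  qed simp
  then show "unit_cost c w i (y i) = unit_cost c w i (x i)"
    using g by (simp add: unit_cost_def case_prod_beta)
qed

lemma primal_feasible_switch_off:
  assumes "x \<in> primal_feasible I gmax d" and "i \<in> I" and "snd (x i) = 0"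
  shows "x(i := (0, 0)) \<in> primal_feasible I gmax d"
proof -
  have "(0, 0) \<in> private_feasible gmax i"
    by (simp add: private_feasible_def)
  moreover have "(\<Sum>j\<in>I. snd ((x(i := (0, 0))) j)) = (\<Sum>j\<in>I. snd (x j))"
    by (rule sum.cong) (auto simp: assms(3))
  ultimately show ?thesis
    using assms(1,2) by (auto simp: primal_feasible_def PiE_iff extensional_def)
qed

lemma total_cost_switch_off:
  assumes "finite I" and "i \<in> I" and "fst (x i) = 1" and "snd (x i) = 0"
  shows "total_cost I c w (x(i := (0, 0))) = total_cost I c w x - w i"
proof -
  have "(\<Sum>j\<in>I - {i}. unit_cost c w j ((x(i := (0, 0))) j))
      = (\<Sum>j\<in>I - {i}. unit_cost c w j (x j))"
    by (rule sum.cong) auto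
  then show ?thesis
    using assms
    by (simp add: total_cost_def sum.remove[OF assms(1,2)] unit_cost_def case_prod_beta)
qed

theorem proposition2:
  fixes I :: "'i set"
    and gmax w :: "'i \<Rightarrow> real"
    and c :: "'i \<Rightarrow> real \<Rightarrow> real"
    and d :: real
  assumes "finite I" and "I \<noteq> {}"
    and "\<And>i. i \<in> I \<Longrightarrow> gmax i > 0"
    and "\<And>i. i \<in> I \<Longrightarrow> w i \<ge> 0"
    and "\<And>i. i \<in> I \<Longrightarrow> mono_on {0..gmax i} (c i)"
    and "\<And>i. i \<in> I \<Longrightarrow> convex_on {0..gmax i} (c i)"
    and "\<And>i. i \<in> I \<Longrightarrow> continuous_on {0..gmax i} (c i)"
    and "\<And>i. i \<in> I \<Longrightarrow> c i 0 = 0"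
    and "0 \<le> d" and "d \<le> (\<Sum>i\<in>I. gmax i)"
  shows "primal_feasible I gmax d - idle_committed I gmax w d = attainable I gmax c w d"
proof (intro equalityI subsetI)
  fix x assume "x \<in> primal_feasible I gmax d - idle_committed I gmax w d"
  then have x: "x \<in> primal_feasible I gmax d" "x \<notin> idle_committed I gmax w d"
    by auto
  have "x \<in> (\<Pi>\<^sub>E i\<in>I. {0, 1} \<times> {0..gmax i})"
    using primal_feasible_within_capacity[OF _ x(1)] assms(3) by (simp add: less_imp_le)
  moreover have "\<not> total_cost I c w y < total_cost I c w x"
    if "y \<in> primal_feasible I gmax d"
      and "\<forall>i\<in>I. fst (y i) \<le> fst (x i) \<and> snd (y i) \<le> snd (x i)" for y
    using total_cost_dominated_eq[OF assms(1) x that(1), of c] that(2) by simp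
  ultimately show "x \<in> attainable I gmax c w d"
    using x(1) by (auto simp: attainable_def is_arg_min_def)
next
  fix x assume "x \<in> attainable I gmax c w d"
  then have x: "x \<in> primal_feasible I gmax d"
    and opt: "\<And>y. y \<in> primal_feasible I gmax d
      \<Longrightarrow> \<forall>i\<in>I. fst (y i) \<le> fst (x i) \<and> snd (y i) \<le> snd (x i)
      \<Longrightarrow> \<not> total_cost I c w y < total_cost I c w x"
    by (auto simp: attainable_def is_arg_min_def)
  have "x \<notin> idle_committed I gmax w d"
  proof
    assume "x \<in> idle_committed I gmax w d"
    then obtain i where i: "i \<in> I" "w i \<noteq> 0" "fst (x i) = 1" "snd (x i) = 0"
      by (auto simp: idle_committed_def)
    have "\<not> total_cost I c w (x(i := (0, 0))) < total_cost I c w x"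
      using opt[OF primal_feasible_switch_off[OF x i(1,4)]] i by auto
    then show False
      using total_cost_switch_off[where x = x and c = c and w = w, OF assms(1) i(1,3,4)] assms(4)[OF i(1)] i(2) by simp
  qed
  with x show "x \<in> primal_feasible I gmax d - idle_committed I gmax w d"
    by simp
qed

end
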